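(* Let $Q=\{(x,y)\in\mathbb{R}^2:0\le x<1,\ 1\le y<2\}$ and let $v:Q\to\mathbb{R}^2$ be a bounded divergence-free vector field tangent to $\partial Q$. Let $u:\mathbb{R}^2_+\to\mathbb{R}^2$ be defined by $u(x,y)=v(2^jx-i,2^jy)$ for $(x,y)\in Q_{i,j}$, $i,j\in\mathbb{Z}$, where $$Q_{i,j}=\Big\{(x,y)\in\mathbb{R}^2:\tfrac{i}{2^j}\le x<\tfrac{i+1}{2^j},\ 2^{-j}\le y<2^{-j+1}\Big\}.$$ Then: (i) $u$ is bounded, divergence-free and $\mathrm{Tr}_n(u;\partial\mathbb{R}^2_+)\equiv0$; (ii) for every $k\in\mathbb{Z}$, the restriction of $u$ to the strip $\{0<y<2^{-k}\}$ is $2^{-k-1}$-periodic in the first variable; (iii) for any $(\bar x,0)\in\partial\mathbb{R}^2_+$, $$\liminf_{r\to0}\frac1{r^2}\int_{B_r^+((\bar x,0))}|u\cdot e_2|\,dx\,dy\ \ge\ \frac18\int_Q|v\cdot e_2|\,dx\,dy.$$ In particular, if $\int_Q|v\cdot e_2|\,dx\,dy>0$, then $u$ does not admit a normal Lebesgue trace on $\partial\mathbb{R}^2_+$.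
   Context: $\mathbb{R}^2_+=\{(x,y):y>0\}$, which is the disjoint union of the $Q_{i,j}$; $\{e_1,e_2\}$ is the canonical basis of $\mathbb{R}^2$; $B_r^+(p)=B_r(p)\cap\mathbb{R}^2_+$. "Divergence-free and tangent to $\partial Q$" means that $v$ has zero divergence in $Q$ and zero normal component on $\partial Q$, i.e. $\int_Qv\cdot\nabla\varphi\,dx\,dy=0$ for all $\varphi\in C^1_c(\mathbb{R}^2)$. For a bounded divergence-free field $u$ on $\mathbb{R}^2_+$ the outward distributional normal trace is $\langle\mathrm{Tr}_n(u;\partial\mathbb{R}^2_+),\varphi\rangle=\int_{\mathbb{R}^2_+}u\cdot\nabla\varphi\,dx\,dy$, $\varphi\in C_c^\infty(\mathbb{R}^2)$. $u$ admits a normal Lebesgue trace on $\partial\mathbb{R}^2_+$ if there is $f\in L^1_{\rm loc}(\partial\mathbb{R}^2_+;\mathcal{H}^1)$ such that for every sequence $r_k\to0^+$, $\frac1{r_k^2}\int_{B^+_{r_k}(p)}|(u\cdot\nabla d)(z)-f(p)|\,dz\to0$ for $\mathcal{H}^1$-a.e. $p\in\partial\mathbb{R}^2_+$, where $d(x,y)=y$ is the distance to $\partial\mathbb{R}^2_+$ (so $\nabla d=e_2$). *)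

theory Defs
  imports "HOL-Analysis.Analysis"
begin

definition half_plane :: "(real \<times> real) set" where
  "half_plane = {z. snd z > 0}"

definition dyadic_cell :: "int \<Rightarrow> int \<Rightarrow> (real \<times> real) set" where
  "dyadic_cell i j =
     {(x, y). of_int i / 2 powi j \<le> x \<and> x < of_int (i + 1) / 2 powi j \<and>
              2 powi (- j) \<le> y \<and> y < 2 powi (- j + 1)}"

definition e2 :: "real \<times> real" where
  "e2 = (0, 1)"

text \<open>The gradient is only meaningful at points of differentiability.\<close>

definition grad :: "('a::real_inner \<Rightarrow> real) \<Rightarrow> 'a \<Rightarrow> 'a" where
  "grad f z = (THE D. GDERIV f z :> D)"

fun C_diff :: "nat \<Rightarrow> ('a::euclidean_space \<Rightarrow> real) \<Rightarrow> bool" where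
  "C_diff 0 f \<longleftrightarrow> continuous_on UNIV f"
| "C_diff (Suc k) f \<longleftrightarrow>
     f differentiable_on UNIV \<and> (\<forall>b\<in>Basis. C_diff k (\<lambda>z. grad f z \<bullet> b))"

definition supp :: "('a::topological_space \<Rightarrow> real) \<Rightarrow> 'a set" where
  "supp f = closure {z. f z \<noteq> 0}"

definition C1_c :: "('a::euclidean_space \<Rightarrow> real) set" where
  "C1_c = {\<phi>. C_diff 1 \<phi> \<and> compact (supp \<phi>)}"

definition Cinf_c :: "('a::euclidean_space \<Rightarrow> real) set" where
  "Cinf_c = {\<phi>. (\<forall>k. C_diff k \<phi>) \<and> compact (supp \<phi>)}"

definition bounded_field :: "(real \<times> real) set \<Rightarrow> (real \<times> real \<Rightarrow> real \<times> real) \<Rightarrow> bool" where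
  "bounded_field S w \<longleftrightarrow> w \<in> borel_measurable (lebesgue_on S) \<and> bounded (w ` S)"

definition div_free :: "(real \<times> real) set \<Rightarrow> (real \<times> real \<Rightarrow> real \<times> real) \<Rightarrow> bool" where
  "div_free S w \<longleftrightarrow>
     (\<forall>\<phi>\<in>Cinf_c. supp \<phi> \<subseteq> S \<longrightarrow> (LINT z|lebesgue_on S. w z \<bullet> grad \<phi> z) = 0)"

text \<open>Testing against functions that need not vanish on the boundary encodes both zero
  divergence inside \<open>S\<close> and zero normal component on its boundary.\<close>

definition div_free_tangent :: "(real \<times> real) set \<Rightarrow> (real \<times> real \<Rightarrow> real \<times> real) \<Rightarrow> bool" where
  "div_free_tangent S w \<longleftrightarrow>
     (\<forall>\<phi>\<in>C1_c. (LINT z|lebesgue_on S. w z \<bullet> grad \<phi> z) = 0)"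

definition normal_trace :: "(real \<times> real \<Rightarrow> real \<times> real) \<Rightarrow> (real \<times> real \<Rightarrow> real) \<Rightarrow> real" where
  "normal_trace w \<phi> = (LINT z|lebesgue_on half_plane. w z \<bullet> grad \<phi> z)"

text \<open>Members of a cover are required to be bounded because \<^const>\<open>diameter\<close> is
  unspecified on unbounded sets.\<close>

definition hausdorff1_pre :: "real \<Rightarrow> 'a::metric_space set \<Rightarrow> ennreal" where
  "hausdorff1_pre \<delta> A =
     (INF E\<in>{E :: nat \<Rightarrow> 'a set. A \<subseteq> (\<Union>n. E n) \<and> (\<forall>n. bounded (E n) \<and> diameter (E n) \<le> \<delta>)}.
        \<Sum>n. ennreal (diameter (E n)))"

definition hausdorff1_outer :: "'a::metric_space set \<Rightarrow> ennreal" where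
  "hausdorff1_outer A = (SUP \<delta>\<in>{0<..}. hausdorff1_pre \<delta> A)"

text \<open>The outer measure is restricted to the sets measurable in Caratheodory's sense.\<close>

definition hausdorff1 :: "'a::metric_space measure" where
  "hausdorff1 = measure_of UNIV (lambda_system UNIV UNIV hausdorff1_outer) hausdorff1_outer"

lemma hausdorff1_pre_subadditive:
  fixes A :: "nat \<Rightarrow> 'a::metric_space set"
  shows "hausdorff1_pre \<delta> (\<Union>i. A i) \<le> (\<Sum>i. hausdorff1_pre \<delta> (A i))"
proof (cases "\<exists>i. hausdorff1_pre \<delta> (A i) = top")
  case True
  then obtain i where "hausdorff1_pre \<delta> (A i) = top" by blast
  moreover have "hausdorff1_pre \<delta> (A i) \<le> (\<Sum>i. hausdorff1_pre \<delta> (A i))"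
    using sum_le_suminf[of "\<lambda>i. hausdorff1_pre \<delta> (A i)" "{i}"] by simp
  ultimately show ?thesis by (simp add: top_unique)
next
  case False
  show ?thesis
  proof (rule ennreal_le_epsilon)
    fix e :: real assume e: "0 < e"
    let ?ok = "\<lambda>i E. A i \<subseteq> (\<Union>n. E n) \<and> (\<forall>n. bounded (E n) \<and> diameter (E n) \<le> \<delta>) \<and>
      (\<Sum>n. ennreal (diameter (E n))) \<le> hausdorff1_pre \<delta> (A i) + ennreal (e * (1/2) ^ Suc i)"
    have "\<exists>E. ?ok i E" for i
    proof -
      have "hausdorff1_pre \<delta> (A i) < hausdorff1_pre \<delta> (A i) + ennreal (e * (1/2) ^ Suc i)"
        using False e by (auto simp add: less_top)
      then have "\<exists>E\<in>{E. A i \<subseteq> (\<Union>n. E n) \<and> (\<forall>n. bounded (E n) \<and> diameter (E n) \<le> \<delta>)}.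
          (\<Sum>n. ennreal (diameter (E n))) < hausdorff1_pre \<delta> (A i) + ennreal (e * (1/2) ^ Suc i)"
        unfolding hausdorff1_pre_def[of \<delta> "A i"] by (subst (asm) INF_less_iff) auto
      then show ?thesis by (auto intro: less_imp_le)
    qed
    then obtain E where E: "\<And>i. ?ok i (E i)" by metis
    define F where "F n = (case prod_decode n of (i, m) \<Rightarrow> E i m)" for n
    have "(\<Union>i. A i) \<subseteq> (\<Union>n. F n)"
    proof
      fix x assume "x \<in> (\<Union>i. A i)"
      then obtain i m where "x \<in> E i m" using E by blast
      then have "x \<in> F (prod_encode (i, m))" by (simp add: F_def)
      then show "x \<in> (\<Union>n. F n)" by blast
    qed
    moreover have "bounded (F n) \<and> diameter (F n) \<le> \<delta>" for n
      using E by (auto simp: F_def split: prod.split)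
    ultimately have "hausdorff1_pre \<delta> (\<Union>i. A i) \<le> (\<Sum>n. ennreal (diameter (F n)))"
      unfolding hausdorff1_pre_def by (intro INF_lower) auto
    also have "\<dots> = (\<Sum>i. \<Sum>m. ennreal (diameter (E i m)))"
      using suminf_ennreal_2dimen[of "\<lambda>i. \<Sum>m. ennreal (diameter (E i m))"
          "\<lambda>p. ennreal (diameter (E (fst p) (snd p)))"]
      by (simp add: F_def case_prod_beta comp_def)
    also have "\<dots> \<le> (\<Sum>i. hausdorff1_pre \<delta> (A i) + ennreal (e * (1/2) ^ Suc i))"
      using E by (intro suminf_le) auto
    also have "\<dots> = (\<Sum>i. hausdorff1_pre \<delta> (A i)) + (\<Sum>i. ennreal (e * (1/2) ^ Suc i))"
      by (rule suminf_add[symmetric]) auto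
    also have "(\<Sum>i. ennreal (e * (1/2) ^ Suc i)) = ennreal e"
      using sums_mult[OF power_half_series, of e] e
      by (intro suminf_ennreal_eq) auto
    finally show "hausdorff1_pre \<delta> (\<Union>i. A i) \<le> (\<Sum>i. hausdorff1_pre \<delta> (A i)) + ennreal e" .
  qed
qed

lemma outer_measure_hausdorff1:
  "outer_measure_space UNIV (hausdorff1_outer :: 'a::metric_space set \<Rightarrow> ennreal)"
proof -
  have "hausdorff1_pre \<delta> ({} :: 'a set) = 0" if "\<delta> > 0" for \<delta>
    unfolding hausdorff1_pre_def
    by (rule antisym[OF INF_lower2[of "\<lambda>_. {}"]]) (use that in auto)
  then have "hausdorff1_outer ({} :: 'a set) \<le> 0"
    unfolding hausdorff1_outer_def by (intro SUP_least) simp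
  then have "positive UNIV (hausdorff1_outer :: 'a set \<Rightarrow> ennreal)"
    by (simp add: positive_def)
  moreover have "increasing UNIV (hausdorff1_outer :: 'a set \<Rightarrow> ennreal)"
    unfolding increasing_def hausdorff1_outer_def hausdorff1_pre_def
    by (intro ballI impI SUP_mono' INF_superset_mono) auto
  moreover have "hausdorff1_outer (\<Union>i. A i) \<le> (\<Sum>i. hausdorff1_outer (A i))" for A :: "nat \<Rightarrow> 'a set"
    unfolding hausdorff1_outer_def[of "\<Union>i. A i"]
  proof (rule SUP_least)
    fix \<delta> :: real assume d: "\<delta> \<in> {0<..}"
    have "hausdorff1_pre \<delta> (\<Union>i. A i) \<le> (\<Sum>i. hausdorff1_pre \<delta> (A i))"
      by (rule hausdorff1_pre_subadditive)
    also have "\<dots> \<le> (\<Sum>i. hausdorff1_outer (A i))"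
      unfolding hausdorff1_outer_def using d by (intro suminf_le SUP_upper) auto
    finally show "hausdorff1_pre \<delta> (\<Union>i. A i) \<le> (\<Sum>i. hausdorff1_outer (A i))" .
  qed
  ultimately show ?thesis
    by (auto simp: outer_measure_space_def countably_subadditive_def)
qed

lemma
  shows space_hausdorff1: "space (hausdorff1 :: 'a::metric_space measure) = UNIV"
    and sets_hausdorff1:
      "sets (hausdorff1 :: 'a measure) = lambda_system UNIV UNIV hausdorff1_outer"
    and emeasure_hausdorff1:
      "A \<in> sets (hausdorff1 :: 'a measure) \<Longrightarrow> emeasure hausdorff1 A = hausdorff1_outer A"
proof -
  interpret sigma_algebra UNIV "UNIV :: 'a set set"
    using sigma_algebra_Pow[of UNIV] by simp
  let ?L = "lambda_system UNIV UNIV (hausdorff1_outer :: 'a set \<Rightarrow> ennreal)"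
  have ms: "measure_space UNIV ?L hausdorff1_outer"
    by (rule caratheodory_lemma[OF outer_measure_hausdorff1])
  then interpret L: sigma_algebra UNIV ?L by (simp add: measure_space_def)
  show "space (hausdorff1 :: 'a measure) = UNIV"
    by (simp add: hausdorff1_def)
  show s: "sets (hausdorff1 :: 'a measure) = ?L"
    by (simp add: hausdorff1_def)
  show "emeasure hausdorff1 A = hausdorff1_outer A" if "A \<in> sets (hausdorff1 :: 'a measure)"
    using that ms s unfolding hausdorff1_def
    by (intro emeasure_measure_of_sigma) (auto simp: measure_space_def)
qed

definition locally_integrable_on :: "'a::metric_space measure \<Rightarrow> 'a set \<Rightarrow> ('a \<Rightarrow> real) \<Rightarrow> bool" where
  "locally_integrable_on M S f \<longleftrightarrow> (\<forall>K. compact K \<and> K \<subseteq> S \<longrightarrow> set_integrable M K f)"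

definition bdry_dist :: "real \<times> real \<Rightarrow> real" where
  "bdry_dist z = snd z"

lemma frontier_half_plane: "frontier half_plane = {z. snd z = 0}"
proof -
  have h: "half_plane = {z. e2 \<bullet> z > 0}"
    by (auto simp: half_plane_def e2_def)
  have "e2 \<noteq> 0" by (simp add: e2_def zero_prod_def)
  then have "frontier half_plane = {z. e2 \<bullet> z = 0}"
    unfolding h using frontier_halfspace_gt[of e2 0] by simp
  then show ?thesis by (simp add: e2_def inner_prod_def)
qed

lemma bdry_dist_eq_infdist:
  assumes "z \<in> half_plane"
  shows "bdry_dist z = infdist z (frontier half_plane)"
proof (rule antisym)
  have "snd z \<le> dist z w" if "w \<in> frontier half_plane" for w
    using dist_snd_le[of z w] that by (auto simp: frontier_half_plane dist_real_def)
  moreover have ne: "frontier half_plane \<noteq> {}"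
    by (auto simp: frontier_half_plane)
  ultimately show "bdry_dist z \<le> infdist z (frontier half_plane)"
    by (auto simp: bdry_dist_def infdist_notempty intro!: cINF_greatest)
  have "infdist z (frontier half_plane) \<le> dist z (fst z, 0)"
    by (rule infdist_le) (simp add: frontier_half_plane)
  also have "\<dots> = bdry_dist z"
    using assms by (cases z) (simp add: dist_Pair_Pair bdry_dist_def half_plane_def dist_real_def)
  finally show "infdist z (frontier half_plane) \<le> bdry_dist z" .
qed

lemma grad_eqI: "GDERIV f z :> D \<Longrightarrow> grad f z = D"
  unfolding grad_def gderiv_def
  by (rule the_equality, assumption)
     (metis has_derivative_unique inner_commute vector_eq_rdot)

lemma grad_bdry_dist: "grad bdry_dist z = e2"
  by (rule grad_eqI)
     (auto simp: gderiv_def bdry_dist_def[abs_def] e2_def inner_prod_def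
       intro!: derivative_eq_intros)

definition is_normal_lebesgue_trace ::
  "(real \<times> real \<Rightarrow> real \<times> real) \<Rightarrow> (real \<times> real \<Rightarrow> real) \<Rightarrow> bool" where
  "is_normal_lebesgue_trace w f \<longleftrightarrow>
     locally_integrable_on hausdorff1 (frontier half_plane) f \<and>
     (\<forall>r :: nat \<Rightarrow> real. filterlim r (at_right 0) sequentially \<longrightarrow>
        (AE p in hausdorff1. p \<in> frontier half_plane \<longrightarrow>
          (\<lambda>k. 1 / (r k)\<^sup>2 *
             (LINT z|lebesgue_on (ball p (r k) \<inter> half_plane). \<bar>w z \<bullet> grad bdry_dist z - f p\<bar>))
          \<longlonglongrightarrow> 0))"

definition admits_normal_lebesgue_trace :: "(real \<times> real \<Rightarrow> real \<times> real) \<Rightarrow> bool" where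
  "admits_normal_lebesgue_trace w \<longleftrightarrow> (\<exists>f. is_normal_lebesgue_trace w f)"

end

theory Submission
  imports Defs
begin

text \<open>The map \<open>(x, y) \<mapsto> (2\<^sup>j x - i, 2\<^sup>j y)\<close> carries the cell \<open>Q\<^sub>i\<^sub>j\<close> onto \<open>Q = Q\<^sub>0\<^sub>0\<close>, and it carries \<open>C\<^sup>1\<^sub>c\<close>
  test functions to \<open>C\<^sup>1\<^sub>c\<close> test functions; tangency of \<open>v\<close> therefore makes \<open>u \<bullet> \<nabla>\<phi>\<close> integrate to zero over
  each single cell, whatever the values of \<open>\<phi>\<close> on the cell boundaries. Summing over cells gives (i).
  A half disc of radius \<open>r\<close> contains cells of total area at least \<open>r\<^sup>2 / 8\<close>, and on each of them the mean of
  \<open>\<bar>u \<bullet> e\<^sub>2 - t\<bar>\<close> is \<open>c(t) = \<integral>\<^sub>Q \<bar>v \<bullet> e\<^sub>2 - t\<bar>\<close>; the case \<open>t = 0\<close> is (iii). Testing \<open>v\<close> against a cut-off of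
  \<open>y\<close> shows that \<open>v \<bullet> e\<^sub>2\<close> has mean zero on \<open>Q\<close>, so \<open>c(t) \<ge> \<bar>t\<bar>\<close>. Hence \<open>c(t) > 0\<close> for all \<open>t\<close> once
  \<open>c(0) > 0\<close>, and no number \<open>t\<close> can be the value of a normal Lebesgue trace at any boundary point.\<close>

section \<open>Lebesgue integrals under scalings and translations\<close>

lemma affine_measurable_lebesgue:
  fixes t :: "'a::euclidean_space"
  assumes "c \<noteq> 0"
  shows "(\<lambda>x. t + c *\<^sub>R x) \<in> lebesgue \<rightarrow>\<^sub>M lebesgue"
  \<comment> \<open>The cited fact scales each coordinate separately; with one common factor,
    reversing \<open>scaleR_scaleR\<close> pulls it out of the sum over the basis.\<close>
  using lebesgue_affine_measurable[of "\<lambda>_. c" t] assms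
  by (simp add: scaleR_scaleR[symmetric] scaleR_sum_right[symmetric] euclidean_representation
      del: scaleR_scaleR)

lemma integral_lebesgue_affine:
  fixes t :: "'a::euclidean_space" and g :: "'a \<Rightarrow> 'b::{banach, second_countable_topology}"
  assumes c: "c \<noteq> 0" and g[measurable]: "g \<in> borel_measurable lebesgue"
  shows "integral\<^sup>L lebesgue g = \<bar>c\<bar> ^ DIM('a) *\<^sub>R (LINT x|lebesgue. g (t + c *\<^sub>R x))"
proof -
  note [measurable] = affine_measurable_lebesgue[OF c, of t]
  have "lebesgue = density (distr lebesgue lebesgue (\<lambda>x. t + c *\<^sub>R x)) (\<lambda>_. ennreal (\<bar>c\<bar> ^ DIM('a)))"
    using lebesgue_affine_euclidean[of "\<lambda>_. c" t] c
    by (simp add: scaleR_scaleR[symmetric] scaleR_sum_right[symmetric] euclidean_representation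
        ennreal_power del: scaleR_scaleR)
  then have "integral\<^sup>L lebesgue g =
      integral\<^sup>L (density (distr lebesgue lebesgue (\<lambda>x. t + c *\<^sub>R x)) (\<lambda>_. ennreal (\<bar>c\<bar> ^ DIM('a)))) g"
    by simp
  also have "\<dots> = \<bar>c\<bar> ^ DIM('a) *\<^sub>R (LINT x|lebesgue. g (t + c *\<^sub>R x))"
    by (subst integral_density) (auto simp: integral_distr)
  finally show ?thesis .
qed

lemma integral_lebesgue_on_eq:
  fixes f :: "'a::euclidean_space \<Rightarrow> 'b::{banach, second_countable_topology}"
  assumes "S \<in> sets lebesgue"
  shows "integral\<^sup>L (lebesgue_on S) f = (LINT x:S|lebesgue. f x)"
  using assms by (simp add: integral_restrict_space set_lebesgue_integral_def)

section \<open>Dyadic cells and the tiling of the half plane\<close>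

text \<open>This is the argument of \<open>v\<close> in the formula for \<open>u\<close>, written as
  translation plus scaling so that the affine change of variables applies as it stands.\<close>

definition cell_map :: "int \<Rightarrow> int \<Rightarrow> real \<times> real \<Rightarrow> real \<times> real" where
  "cell_map i j z = (- of_int i, 0) + (2 powi j) *\<^sub>R z"

lemma cell_map_Pair: "cell_map i j (x, y) = (2 powi j * x - of_int i, 2 powi j * y)"
  by (simp add: cell_map_def)

lemma mem_unit_cell: "(x, y) \<in> dyadic_cell 0 0 \<longleftrightarrow> 0 \<le> x \<and> x < 1 \<and> 1 \<le> y \<and> y < 2"
  by (simp add: dyadic_cell_def)

text \<open>Reduces every question about a cell to inequalities on the unit cell, with no divisions
  by powers of 2.\<close>

lemma mem_dyadic_cell_iff: "z \<in> dyadic_cell i j \<longleftrightarrow> cell_map i j z \<in> dyadic_cell 0 0"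
proof (cases z)
  case (Pair x y)
  define c :: real where "c = 2 powi j"
  have c: "c > 0" by (simp add: c_def)
  have e: "(2::real) powi (- j + 1) = 2 / c" "(2::real) powi (- j) = 1 / c"
    by (simp_all add: c_def power_int_diff power_int_minus divide_inverse)
  have "of_int i / c \<le> x \<longleftrightarrow> 0 \<le> c * x - of_int i"
    "x < of_int (i + 1) / c \<longleftrightarrow> c * x - of_int i < 1"
    "1 / c \<le> y \<longleftrightarrow> 1 \<le> c * y" "y < 2 / c \<longleftrightarrow> c * y < 2"
    using c by (auto simp: field_simps)
  then show ?thesis
    unfolding Pair cell_map_Pair mem_unit_cell dyadic_cell_def mem_Collect_eq prod.case e c_def[symmetric]
    by simp
qed

lemma dyadic_cell_unique:
  assumes "z \<in> dyadic_cell i j" "z \<in> dyadic_cell i' j'"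
  shows "i = i' \<and> j = j'"
proof -
  obtain x y where z: "z = (x, y)" by (cases z)
  \<comment> \<open>If b < a, then 2^(b+1) y \<le> 2^a y < 2, against 1 \<le> 2^b y. Used in both
    directions, this shows that \<open>y\<close> determines the level.\<close>
  have le: "a \<le> b" if "(2::real) powi a * y < 2" "1 \<le> 2 powi b * y" for a b :: int
  proof (rule ccontr)
    assume "\<not> a \<le> b"
    then have "(2::real) powi (b + 1) \<le> 2 powi a" by (intro power_int_increasing) auto
    moreover have "y > 0" using that(2) by (smt (verit) mult_nonneg_nonpos zero_le_power_int)
    ultimately have "2 powi (b + 1) * y \<le> 2 powi a * y" by (simp add: mult_right_mono)
    with that show False by (simp add: power_int_add)
  qed
  have 1: "0 \<le> 2 powi j * x - of_int i" "2 powi j * x - of_int i < 1" "1 \<le> 2 powi j * y" "2 powi j * y < 2"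
    using assms(1) unfolding z mem_dyadic_cell_iff[of _ i j] cell_map_Pair mem_unit_cell by auto
  have 2: "0 \<le> 2 powi j' * x - of_int i'" "2 powi j' * x - of_int i' < 1" "1 \<le> 2 powi j' * y" "2 powi j' * y < 2"
    using assms(2) unfolding z mem_dyadic_cell_iff[of _ i' j'] cell_map_Pair mem_unit_cell by auto
  have "j = j'" using le[of j j'] le[of j' j] 1 2 by linarith
  moreover have "real_of_int i < of_int i' + 1" "real_of_int i' < of_int i + 1"
    using 1 2 unfolding \<open>j = j'\<close> by linarith+
  ultimately show ?thesis by linarith
qed

text \<open>With j = -floor(log2 y), the product 2^j y is 2 to the fractional part of log2
  y.\<close>

lemma dyadic_bracket:
  assumes "(y::real) > 0"
  obtains j :: int where "1 \<le> 2 powi j * y" "2 powi j * y < 2"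
proof
  define j where "j = - \<lfloor>log 2 y\<rfloor>"
  have eq: "2 powi j * y = 2 powr (log 2 y - of_int \<lfloor>log 2 y\<rfloor>)"
    using assms by (simp add: j_def powr_diff powr_real_of_int' power_int_minus field_simps)
  have "0 \<le> log 2 y - of_int \<lfloor>log 2 y\<rfloor>" "log 2 y - of_int \<lfloor>log 2 y\<rfloor> < 1" by linarith+
  then show "1 \<le> 2 powi j * y" "2 powi j * y < 2"
    unfolding eq using powr_less_mono[of "log 2 y - of_int \<lfloor>log 2 y\<rfloor>" 1 2] ge_one_powr_ge_zero by auto
qed

lemma half_plane_eq_Union: "half_plane = (\<Union>i j. dyadic_cell i j)"
proof (intro equalityI subsetI)
  fix z assume z: "z \<in> half_plane"
  obtain x y where z': "z = (x, y)" by (cases z)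
  with z have "y > 0" by (simp add: half_plane_def)
  then obtain j :: int where "1 \<le> 2 powi j * y" "2 powi j * y < 2" by (rule dyadic_bracket)
  then have "z \<in> dyadic_cell \<lfloor>2 powi j * x\<rfloor> j"
    unfolding z' mem_dyadic_cell_iff[of _ _ j] cell_map_Pair mem_unit_cell by auto linarith
  then show "z \<in> (\<Union>i j. dyadic_cell i j)" by blast
next
  fix z assume "z \<in> (\<Union>i j. dyadic_cell i j)"
  then obtain i j where "z \<in> dyadic_cell i j" by blast
  then show "z \<in> half_plane"
    using less_le_trans[OF zero_less_power_int[of "2::real" "- j"]]
    by (cases z) (auto simp: dyadic_cell_def half_plane_def)
qed

section \<open>Measurability and integration over cells\<close>

lemma dyadic_cell_borel: "dyadic_cell i j \<in> sets borel"
proof -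
  have "dyadic_cell i j =
      {of_int i / 2 powi j ..< of_int (i + 1) / 2 powi j} \<times> {2 powi (- j) ..< 2 powi (- j + 1)}"
    by (auto simp: dyadic_cell_def)
  then show ?thesis by (simp add: borel_Times)
qed

lemma dyadic_cell_lebesgue [measurable, simp]: "dyadic_cell i j \<in> sets lebesgue"
  using dyadic_cell_borel by (simp add: sets_completionI_sets)

lemma half_plane_lebesgue [measurable, simp]: "half_plane \<in> sets lebesgue"
  unfolding half_plane_eq_Union by (intro sets.countable_UN'' dyadic_cell_lebesgue) simp_all

lemma cell_map_measurable [measurable]: "cell_map i j \<in> lebesgue \<rightarrow>\<^sub>M lebesgue"
  unfolding cell_map_def[abs_def] by (rule affine_measurable_lebesgue) simp

lemma indicator_dyadic_cell: "indicator (dyadic_cell i j) z = indicator (dyadic_cell 0 0) (cell_map i j z)"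
  by (simp add: indicator_def mem_dyadic_cell_iff[of z i j])

text \<open>Extended by zero, \<open>F\<close> is measurable on the whole plane, where it can be
  composed with \<open>cell_map\<close>; the indicator pulls back to that of the cell.\<close>

lemma cell_map_measurable_on:
  fixes F :: "real \<times> real \<Rightarrow> 'b::real_normed_vector"
  assumes "F \<in> borel_measurable (lebesgue_on (dyadic_cell 0 0))"
  shows "(\<lambda>z. F (cell_map i j z)) \<in> borel_measurable (lebesgue_on (dyadic_cell i j))"
proof -
  have [measurable]: "(\<lambda>x. indicat_real (dyadic_cell 0 0) x *\<^sub>R F x) \<in> borel_measurable lebesgue"
    using assms by (simp add: borel_measurable_restrict_space_iff)
  have "(\<lambda>z. (\<lambda>x. indicat_real (dyadic_cell 0 0) x *\<^sub>R F x) (cell_map i j z)) \<in> borel_measurable lebesgue"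
    by measurable
  then show ?thesis
    by (simp add: borel_measurable_restrict_space_iff indicator_dyadic_cell[of i j])
qed

text \<open>Change of variables: (2^j)^2 is the Jacobian of \<open>cell_map i j\<close> in the
  plane.\<close>

lemma set_integral_dyadic_cell:
  fixes F :: "real \<times> real \<Rightarrow> 'b::{banach, second_countable_topology}"
  assumes "F \<in> borel_measurable (lebesgue_on (dyadic_cell 0 0))"
  shows "(LINT z:dyadic_cell 0 0|lebesgue. F z) =
    (2 powi j)\<^sup>2 *\<^sub>R (LINT z:dyadic_cell i j|lebesgue. F (cell_map i j z))"
proof -
  have "(\<lambda>x. indicat_real (dyadic_cell 0 0) x *\<^sub>R F x) \<in> borel_measurable lebesgue"
    using assms by (simp add: borel_measurable_restrict_space_iff)
  from integral_lebesgue_affine[OF _ this, of "2 powi j" "(- of_int i, 0)"]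
  show ?thesis
    unfolding set_lebesgue_integral_def indicator_dyadic_cell[of i j]
    by (simp add: cell_map_def power2_eq_square)
qed

lemma set_integrable_lebesgue_bounded:
  fixes f :: "'a::euclidean_space \<Rightarrow> 'b::{banach, second_countable_topology}"
  assumes S: "S \<in> lmeasurable" and f: "f \<in> borel_measurable (lebesgue_on S)"
    and B: "\<And>z. z \<in> S \<Longrightarrow> norm (f z) \<le> B"
  shows "set_integrable lebesgue S f"
  unfolding set_integrable_def
proof (rule Bochner_Integration.integrable_bound)
  have S': "S \<in> sets lebesgue" using S by (rule fmeasurableD)
  show "integrable lebesgue (\<lambda>z. B * indicat_real S z)"
    using integrable_real_indicator[OF S'] fmeasurableD2[OF S] by (simp add: less_top)
  show "(\<lambda>x. indicat_real S x *\<^sub>R f x) \<in> borel_measurable lebesgue"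
    using f S' by (simp add: borel_measurable_restrict_space_iff)
  show "AE z in lebesgue. norm (indicat_real S z *\<^sub>R f z) \<le> norm (B * indicat_real S z)"
  proof (intro AE_I2)
    fix z show "norm (indicat_real S z *\<^sub>R f z) \<le> norm (B * indicat_real S z)"
    proof (cases "z \<in> S")
      case True
      then show ?thesis using B[OF True] by simp
    qed simp
  qed
qed

lemma dyadic_cell_lmeasurable [simp]: "dyadic_cell i j \<in> lmeasurable"
proof -
  have "bounded {a..<b :: real}" for a b
    by (rule bounded_subset[OF bounded_closed_interval[of a b]]) auto
  from bounded_Times[OF this this] have "bounded (dyadic_cell i j)"
    by (rule bounded_subset) (auto simp: dyadic_cell_def)
  then show ?thesis by (rule bounded_set_imp_lmeasurable) simp
qed

text \<open>Countable additivity over the disjoint cells; integrability on the whole half plane is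
  what justifies summing cell by cell.\<close>

lemma lint_half_plane_eq_0:
  fixes f :: "real \<times> real \<Rightarrow> 'b::{banach, second_countable_topology}"
  assumes "set_integrable lebesgue half_plane f"
    and "\<And>i j. (LINT z:dyadic_cell i j|lebesgue. f z) = 0"
  shows "(LINT z:half_plane|lebesgue. f z) = 0"
proof -
  \<comment> \<open>Countable additivity is indexed by naturals, so the index pairs are
    enumerated.\<close>
  obtain e :: "nat \<Rightarrow> int \<times> int" where e: "bij e"
    using bij_betw_from_nat_into[of "UNIV :: (int \<times> int) set"] by (auto simp: finite_prod)
  define A where "A n = dyadic_cell (fst (e n)) (snd (e n))" for n
  have eq: "half_plane = (\<Union>n. A n)"
  proof -
    have "(\<Union>n. A n) = (\<Union>p\<in>range e. dyadic_cell (fst p) (snd p))" by (simp add: A_def)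
    also have "range e = UNIV" using e by (simp add: bij_def)
    also have "(\<Union>p. dyadic_cell (fst p) (snd p)) = half_plane"
      unfolding half_plane_eq_Union by force
    finally show ?thesis by simp
  qed
  have disj: "A m \<inter> A n = {}" if "m \<noteq> n" for m n
  proof -
    have "e m \<noteq> e n" using e that by (auto simp: bij_def inj_def)
    then show ?thesis unfolding A_def using dyadic_cell_unique by (metis disjoint_iff prod_eqI)
  qed
  have "(LINT z:half_plane|lebesgue. f z) = (\<Sum>n. LINT z:A n|lebesgue. f z)"
    unfolding eq using assms(1) disj by (intro lebesgue_integral_countable_add) (auto simp: A_def eq)
  then show ?thesis using assms(2) by (simp add: A_def)
qed

section \<open>Compactly supported test functions and their gradients\<close>

text \<open>\<open>grad\<close> is a definite description, so a gradient must be exhibited first. A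
  derivative D is a linear functional, hence the inner product with
  \<open>adjoint D 1\<close>.\<close>

lemma C1_c_GDERIV:
  assumes "\<phi> \<in> C1_c"
  shows "GDERIV \<phi> z :> grad \<phi> z"
proof -
  have "\<phi> differentiable (at z)"
    using assms by (simp add: C1_c_def differentiable_on_def)
  then obtain D where D: "(\<phi> has_derivative D) (at z)" by (auto simp: differentiable_def)
  then have "linear D" by (rule has_derivative_linear)
  then have "D = (\<lambda>h. h \<bullet> adjoint D 1)"
    using adjoint_works[of D] by (simp add: fun_eq_iff)
  with D have "GDERIV \<phi> z :> adjoint D 1" by (simp add: gderiv_def)
  then show ?thesis using grad_eqI by metis
qed

lemma C1_c_continuous_grad:
  assumes "\<phi> \<in> C1_c"
  shows "continuous_on UNIV (grad \<phi>)"
  using assms unfolding continuous_on_componentwise[of _ "grad \<phi>"] by (simp add: C1_c_def)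

lemma compact_suppI:
  fixes f :: "'a::{t2_space} \<Rightarrow> real"
  assumes "compact K" "\<And>z. z \<notin> K \<Longrightarrow> f z = 0"
  shows "compact (supp f)"
proof -
  have "supp f \<subseteq> K" unfolding supp_def
    using assms by (intro closure_minimal) (auto simp: compact_imp_closed)
  then have "supp f = K \<inter> supp f" by auto
  then show ?thesis using assms(1) by (metis closed_closure compact_Int_closed supp_def)
qed

text \<open>Lets explicit test functions be checked without computing \<open>grad\<close> or the
  exact support.\<close>

lemma C1_cI:
  assumes D: "\<And>z. GDERIV \<phi> z :> D z" and c: "continuous_on UNIV D"
    and K: "compact K" "\<And>z. z \<notin> K \<Longrightarrow> \<phi> z = 0"
  shows "\<phi> \<in> C1_c"
proof -
  have g: "grad \<phi> = D" using D grad_eqI by blast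
  have "\<phi> differentiable_on UNIV"
    using D by (auto simp: differentiable_on_def differentiable_def gderiv_def)
  then show ?thesis
    using c compact_suppI[OF K] by (auto simp: C1_c_def g intro!: continuous_intros)
qed

lemma Cinf_c_subset_C1_c: "Cinf_c \<subseteq> C1_c"
  unfolding Cinf_c_def C1_c_def by blast

lemma grad_eq_0_outside_supp:
  assumes "z \<notin> supp \<phi>"
  shows "grad \<phi> z = 0"
proof (rule grad_eqI)
  have "((\<lambda>_. 0) has_derivative (\<lambda>_. 0)) (at z)" by simp
  then have "(\<phi> has_derivative (\<lambda>_. 0)) (at z)"
    by (rule has_derivative_transform_within_open[where s = "- supp \<phi>"])
      (use assms closure_subset[of "{z. \<phi> z \<noteq> 0}"] in \<open>auto simp: supp_def\<close>)
  then show "GDERIV \<phi> z :> 0" by (simp add: gderiv_def)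
qed

lemma C1_c_integrable_grad:
  fixes \<phi> :: "'a::euclidean_space \<Rightarrow> real"
  assumes "\<phi> \<in> C1_c"
  shows "integrable lebesgue (grad \<phi>)"
proof -
  have K: "compact (supp \<phi>)" using assms by (simp add: C1_c_def)
  have "integrable lborel (\<lambda>x. indicator (supp \<phi>) x *\<^sub>R grad \<phi> x)"
    using C1_c_continuous_grad[OF assms] K by (intro borel_integrable_compact) (auto intro: continuous_on_subset)
  also have "(\<lambda>x. indicator (supp \<phi>) x *\<^sub>R grad \<phi> x) = grad \<phi>"
    using grad_eq_0_outside_supp[of _ \<phi>] by (auto simp: fun_eq_iff indicator_def)
  finally show ?thesis by (simp add: integrable_completion borel_measurable_integrable)
qed

lemma GDERIV_affine:
  assumes "GDERIV \<phi> (t + c *\<^sub>R w) :> D"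
  shows "GDERIV (\<lambda>w. \<phi> (t + c *\<^sub>R w)) w :> c *\<^sub>R D"
proof -
  have "((\<lambda>w. t + c *\<^sub>R w) has_derivative (\<lambda>h. c *\<^sub>R h)) (at w)"
    by (auto intro!: derivative_eq_intros)
  from has_derivative_compose[OF this assms[unfolded gderiv_def]] show ?thesis
    by (simp add: gderiv_def)
qed

text \<open>The chain rule gives the gradient, and the function vanishes off the image of the
  compact support under the inverse affine map.\<close>

lemma C1_c_affine:
  fixes \<phi> :: "'a::euclidean_space \<Rightarrow> real"
  assumes \<phi>: "\<phi> \<in> C1_c" and c: "c \<noteq> 0"
  shows "(\<lambda>w. \<phi> (t + c *\<^sub>R w)) \<in> C1_c"
proof (rule C1_cI)
  show "GDERIV (\<lambda>w. \<phi> (t + c *\<^sub>R w)) z :> c *\<^sub>R grad \<phi> (t + c *\<^sub>R z)" for z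
    by (intro GDERIV_affine C1_c_GDERIV \<phi>)
  show "continuous_on UNIV (\<lambda>z. c *\<^sub>R grad \<phi> (t + c *\<^sub>R z))"
    by (intro continuous_intros continuous_on_compose2[OF C1_c_continuous_grad[OF \<phi>]]) auto
  show "compact ((\<lambda>z. (1 / c) *\<^sub>R (z - t)) ` supp \<phi>)"
    using \<phi> by (intro compact_continuous_image continuous_intros) (simp add: C1_c_def)
  fix w assume w: "w \<notin> (\<lambda>z. (1 / c) *\<^sub>R (z - t)) ` supp \<phi>"
  have "t + c *\<^sub>R w \<notin> supp \<phi>"
  proof
    assume "t + c *\<^sub>R w \<in> supp \<phi>"
    then have "(1 / c) *\<^sub>R (t + c *\<^sub>R w - t) \<in> (\<lambda>z. (1 / c) *\<^sub>R (z - t)) ` supp \<phi>"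
      by (rule imageI)
    with w c show False by simp
  qed
  then show "\<phi> (t + c *\<^sub>R w) = 0"
    using closure_subset[of "{z. \<phi> z \<noteq> 0}"] by (auto simp: supp_def)
qed

section \<open>A test function with vertical gradient on the unit cell\<close>

text \<open>A \<open>C\<^sup>1\<close> substitute for the positive part.\<close>

definition pos_square :: "real \<Rightarrow> real" where
  "pos_square x = (max 0 x)\<^sup>2"

lemma pos_square_DERIV: "(pos_square has_field_derivative 2 * max 0 x) (at x)"
proof -
  consider "x < 0" | "x > 0" | "x = 0" by linarith
  then show ?thesis
  proof cases
    case 1
    have "((\<lambda>_. 0) has_field_derivative 2 * max 0 x) (at x)" using 1 by simp
    then show ?thesis
      by (rule has_field_derivative_transform_within_open[where S = "{..<0}"])
        (use 1 in \<open>auto simp: pos_square_def\<close>)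
  next
    case 2
    have "((\<lambda>x. x\<^sup>2) has_field_derivative 2 * max 0 x) (at x)"
      using 2 by (auto intro!: derivative_eq_intros)
    then show ?thesis
      by (rule has_field_derivative_transform_within_open[where S = "{0<..}"])
        (use 2 in \<open>auto simp: pos_square_def\<close>)
  next
    case 3
    \<comment> \<open>At the junction point the difference quotient is at most |h| in absolute
      value.\<close>
    have "(\<lambda>h. pos_square h / h) \<midarrow>0\<rightarrow> 0"
    proof (rule Lim_null_comparison)
      show "\<forall>\<^sub>F h in at 0. norm (pos_square h / h) \<le> \<bar>h\<bar>"
        by (intro always_eventually) (auto simp: pos_square_def power2_eq_square max_def)
    qed (auto intro!: tendsto_eq_intros)
    then show ?thesis unfolding 3 DERIV_def by (simp add: pos_square_def)
  qed
qed

text \<open>Take the height function times a radial cut-off that equals 1 on the unit cell; tested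
  against \<open>v\<close>, it yields the mean of the vertical component.\<close>

lemma vertical_test_function:
  obtains \<phi> where "\<phi> \<in> C1_c" "\<And>z. z \<in> dyadic_cell 0 0 \<Longrightarrow> grad \<phi> z = e2"
proof -
  \<comment> \<open>On the unit cell |z|^2 \<le> 1 + 4 = 5. The cut-off is 1 where |z|^2 \<le> 5 and
    0 where |z|^2 \<ge> 6.\<close>
  define \<psi> where "\<psi> z = pos_square (1 - pos_square (z \<bullet> z - 5))" for z :: "real \<times> real"
  define \<phi> where "\<phi> z = snd z * \<psi> z" for z :: "real \<times> real"
  \<comment> \<open>Chain rule: the derivative of the cut-off at \<open>z\<close> is h \<mapsto> g z
    * (z \<bullet> h). The constant -8 collects 2 and -2 from the two uses of
    \<open>pos_square\<close> and 2 from z \<bullet> z.\<close>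
  define g where "g z = - 8 * max 0 (1 - pos_square (z \<bullet> z - 5)) * max 0 (z \<bullet> z - 5)" for z :: "real \<times> real"
  define D where "D z = \<psi> z *\<^sub>R e2 + (snd z * g z) *\<^sub>R z" for z
  note P = pos_square_DERIV[unfolded has_field_derivative_def, THEN has_derivative_compose[rotated]]
  have \<psi>: "(\<psi> has_derivative (\<lambda>h. g z * (z \<bullet> h))) (at z)" for z
    unfolding \<psi>_def[abs_def]
    by (rule has_derivative_eq_rhs, rule P, rule derivative_intros, rule derivative_intros, rule P)
      (auto intro!: derivative_eq_intros simp: g_def inner_commute algebra_simps)
  have D: "GDERIV \<phi> z :> D z" for z
    unfolding \<phi>_def[abs_def] gderiv_def
    by (rule has_derivative_eq_rhs, rule has_derivative_mult[OF _ \<psi>], rule derivative_intros, rule has_derivative_ident)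
      (auto simp: D_def e2_def inner_prod_def algebra_simps fun_eq_iff)
  have cP: "continuous_on UNIV pos_square"
    unfolding pos_square_def by (intro continuous_intros)
  have "\<phi> \<in> C1_c"
  proof (rule C1_cI[OF D])
    show "continuous_on UNIV D"
      unfolding D_def[abs_def] g_def[abs_def] \<psi>_def[abs_def]
      by (intro continuous_intros continuous_on_compose2[OF cP]) auto
    \<comment> \<open>Any radius with square at least 6 would do; here 9.\<close>
    show "compact (cball (0 :: real \<times> real) 3)" by simp
    fix z :: "real \<times> real" assume "z \<notin> cball 0 3"
    then have "3\<^sup>2 < (norm z)\<^sup>2" by (intro power_strict_mono) auto
    then have "6 < z \<bullet> z" by (simp add: dot_square_norm)
    then have "1\<^sup>2 \<le> (z \<bullet> z - 5)\<^sup>2" by (intro power_mono) auto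
    then have "1 \<le> pos_square (z \<bullet> z - 5)" using \<open>6 < z \<bullet> z\<close> by (simp add: pos_square_def)
    then show "\<phi> z = 0" by (simp add: \<phi>_def \<psi>_def pos_square_def[of "1 - _"])
  qed
  moreover have "grad \<phi> z = e2" if z: "z \<in> dyadic_cell 0 0" for z
  proof -
    obtain x y where xy: "z = (x, y)" by (cases z)
    have "x\<^sup>2 \<le> 1\<^sup>2" "y\<^sup>2 \<le> 2\<^sup>2"
      using z unfolding xy mem_unit_cell by (intro power_mono; simp)+
    then have "z \<bullet> z \<le> 5" by (simp add: xy inner_prod_def power2_eq_square)
    then have "D z = e2" by (simp add: D_def g_def \<psi>_def pos_square_def)
    then show ?thesis using grad_eqI[OF D] by simp
  qed
  ultimately show thesis by (rule that)
qed

lemma measure_unit_cell: "measure lebesgue (dyadic_cell 0 0) = 1"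
proof -
  have "dyadic_cell 0 0 = {0..<1} \<times> {1..<2}" by (auto simp: mem_unit_cell)
  then have "emeasure lborel (dyadic_cell 0 0) = emeasure (lborel \<Otimes>\<^sub>M lborel) ({0..<1::real} \<times> {1..<2::real})"
    by (simp add: lborel_prod)
  also have "\<dots> = emeasure lborel {0..<1::real} * emeasure lborel {1..<2::real}"
    by (rule lborel.emeasure_pair_measure_Times) simp_all
  also have "\<dots> = 1" by simp
  finally show ?thesis using dyadic_cell_borel by (simp add: measure_def)
qed

section \<open>Packing dyadic cells into half discs\<close>

text \<open>The box |x - xbar| \<le> a, 0 < y < a lies in the half disc because 2 a^2 \<le> r^2. The
  condition on \<open>j\<close> keeps the top of the row, 2 * 2^(-j), at height at most
  \<open>a\<close>; those on \<open>i\<close> keep the sides of the cell within the box.\<close>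

lemma dyadic_cell_subset_half_disc:
  assumes a: "0 < a" "2 * a\<^sup>2 \<le> r\<^sup>2" "0 < r" and j: "2 \<le> a * 2 powi j"
    and i: "(xbar - a) * 2 powi j \<le> of_int i" "of_int i + 1 \<le> (xbar + a) * 2 powi j"
  shows "dyadic_cell i j \<subseteq> ball (xbar, 0) r \<inter> half_plane"
proof
  fix z assume z: "z \<in> dyadic_cell i j"
  obtain x y where xy: "z = (x, y)" by (cases z)
  define c :: real where "c = 2 powi j"
  have c: "c > 0" by (simp add: c_def)
  have 1: "0 \<le> c * x - of_int i" "c * x - of_int i < 1" "1 \<le> c * y" "c * y < 2"
    using z unfolding xy mem_dyadic_cell_iff[of _ i j] cell_map_Pair mem_unit_cell c_def by auto
  have "c * (xbar - a) \<le> c * x" "c * x \<le> c * (xbar + a)" "c * y < c * a" "c * 0 < c * y"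
    using 1 i j unfolding c_def[symmetric] by (auto simp: algebra_simps)
  then have "\<bar>x - xbar\<bar> \<le> a" and y: "0 < y" "y < a"
    using c by (auto simp: zero_less_mult_iff)
  then have "(x - xbar)\<^sup>2 \<le> a\<^sup>2" "y\<^sup>2 < a\<^sup>2"
    by (auto simp: abs_le_square_iff[symmetric] intro!: power_strict_mono)
  then have "(x - xbar)\<^sup>2 + y\<^sup>2 < r\<^sup>2" using a(2) by simp
  then have "sqrt ((x - xbar)\<^sup>2 + y\<^sup>2) < r" using a(3) by (simp add: real_less_lsqrt)
  then show "z \<in> ball (xbar, 0) r \<inter> half_plane"
    using y by (simp add: xy half_plane_def dist_Pair_Pair dist_real_def power2_commute)
qed

text \<open>Cells of level m + n have side a / 2^n, so an interval of length 2 a is 2 * 2^n sides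
  long. Wherever it sits relative to the grid, it contains all but one of that many whole cells. For
  n \<ge> 1 the row lies below height \<open>a\<close>.\<close>

lemma dyadic_row_in_half_disc:
  fixes m :: int and n :: nat
  assumes a: "a * 2 powi m = 1" "2 * a\<^sup>2 \<le> r\<^sup>2" "0 < r" and n: "n \<ge> 1"
  obtains I :: "int set" where "finite I" "card I = 2 * 2 ^ n - 1"
    "\<And>i. i \<in> I \<Longrightarrow> dyadic_cell i (m + int n) \<subseteq> ball (xbar, 0) r \<inter> half_plane"
proof
  \<comment> \<open>Index of the first cell whose left edge is at or right of xbar - a.\<close>
  define k where "k = \<lceil>(xbar - a) * 2 powi (m + int n)\<rceil>"
  have eq: "a * 2 powi (m + int n) = 2 ^ n"
    using a(1) by (simp add: power_int_add mult.assoc[symmetric])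
  show "finite {k..<k + (2 * 2 ^ n - 1)}" by simp
  have "int (2 * 2 ^ n - 1) = 2 * 2 ^ n - 1" by (simp add: of_nat_diff)
  then show "card {k..<k + (2 * 2 ^ n - 1)} = 2 * 2 ^ n - 1"
    by (metis add_diff_cancel_left' card_atLeastLessThan_int nat_int)
  have "0 < a" using a(1) by (metis mult_nonpos_nonneg not_le zero_le_power_int zero_le_numeral zero_less_one)
  moreover have "(2::real) \<le> a * 2 powi (m + int n)"
    unfolding eq using n power_increasing[of 1 n "2::real"] by simp
  moreover fix i assume i: "i \<in> {k..<k + (2 * 2 ^ n - 1)}"
  have "(xbar - a) * 2 powi (m + int n) \<le> of_int i"
    using i le_of_int_ceiling[of "(xbar - a) * 2 powi (m + int n)"] unfolding k_def[symmetric] by simp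
  moreover have "real_of_int i + 1 \<le> (xbar + a) * 2 powi (m + int n)"
  proof -
    have "i + 1 \<le> k + (2 * 2 ^ n - 1)" using i by auto
    then have "real_of_int (i + 1) \<le> real_of_int (k + (2 * 2 ^ n - 1))" by (rule of_int_le_iff[THEN iffD2])
    moreover have "real_of_int k < (xbar - a) * 2 powi (m + int n) + 1" unfolding k_def by linarith
    moreover have "(xbar + a) * 2 powi (m + int n) = (xbar - a) * 2 powi (m + int n) + 2 * 2 ^ n"
      unfolding eq[symmetric] by (simp add: algebra_simps)
    ultimately show ?thesis by simp
  qed
  ultimately show "dyadic_cell i (m + int n) \<subseteq> ball (xbar, 0) r \<inter> half_plane"
    using a by (intro dyadic_cell_subset_half_disc)
qed

lemma half_disc_lmeasurable [simp]: "ball (xbar, 0) r \<inter> half_plane \<in> lmeasurable"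
  by (intro bounded_set_imp_lmeasurable) (auto intro: bounded_subset[OF bounded_ball])

text \<open>With \<open>a\<close> a dyadic length such that \<open>2 a\<^sup>2 \<le> r\<^sup>2 < 8 a\<^sup>2\<close>, the half disc contains 3 cells of side \<open>a / 2\<close> and 7 cells
  of side \<open>a / 4\<close>, of total area \<open>19 a\<^sup>2 / 16 > r\<^sup>2 / 8\<close>.\<close>

lemma half_disc_lower_bound:
  fixes G w :: "real \<times> real \<Rightarrow> real"
  assumes G: "G \<in> borel_measurable (lebesgue_on (dyadic_cell 0 0))"
    and w: "\<And>i j z. z \<in> dyadic_cell i j \<Longrightarrow> w z = G (cell_map i j z)"
    and w_int: "set_integrable lebesgue (ball (xbar, 0) r \<inter> half_plane) w"
    and w_nonneg: "\<And>z. z \<in> half_plane \<Longrightarrow> 0 \<le> w z" and r: "0 < r"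
  shows "r\<^sup>2 / 8 * (LINT z:dyadic_cell 0 0|lebesgue. G z) \<le> (LINT z:ball (xbar, 0) r \<inter> half_plane|lebesgue. w z)"
    (is "_ * ?J \<le> ?R")
proof -
  let ?B = "ball (xbar, 0) r \<inter> half_plane"
  obtain m :: int where m: "1 \<le> 2 powi m * (r / sqrt 2)" "2 powi m * (r / sqrt 2) < 2"
    using dyadic_bracket[of "r / sqrt 2"] r by auto
  define c :: real where "c = 2 powi m"
  define a where "a = 1 / c"
  have c: "c > 0" by (simp add: c_def)
  have ac: "a * c = 1" using c by (simp add: a_def)
  have a: "a \<le> r / sqrt 2" "r / sqrt 2 < 2 * a" "a > 0"
    using m c unfolding a_def c_def[symmetric] by (auto simp: field_simps)
  have "a\<^sup>2 \<le> (r / sqrt 2)\<^sup>2" "(r / sqrt 2)\<^sup>2 < (2 * a)\<^sup>2"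
    using a r by (intro power_mono power_strict_mono; simp)+
  then have ar: "2 * a\<^sup>2 \<le> r\<^sup>2" "r\<^sup>2 < 8 * a\<^sup>2"
    by (auto simp: power_divide power_mult_distrib)
  \<comment> \<open>The first row has area only 3 a^2 / 4, while r^2 / 8 may be close to a^2; the
    second row, of area 7 a^2 / 16, closes the gap.\<close>
  obtain I1 where I1: "finite I1" "card I1 = 2 * 2 ^ 1 - 1"
    "\<And>i. i \<in> I1 \<Longrightarrow> dyadic_cell i (m + int 1) \<subseteq> ?B"
    using dyadic_row_in_half_disc[of a m r 1 xbar] ac ar r unfolding c_def by auto
  obtain I2 where I2: "finite I2" "card I2 = 2 * 2 ^ 2 - 1"
    "\<And>i. i \<in> I2 \<Longrightarrow> dyadic_cell i (m + int 2) \<subseteq> ?B"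
    using dyadic_row_in_half_disc[of a m r 2 xbar] ac ar r unfolding c_def by auto
  define C where "C = (\<lambda>i. (i, m + 1)) ` I1 \<union> (\<lambda>i. (i, m + 2)) ` I2"
  define A where "A p = dyadic_cell (fst p) (snd p)" for p
  have C: "finite C" using I1 I2 by (simp add: C_def)
  have AB: "A p \<subseteq> ?B" if "p \<in> C" for p
  proof -
    consider i where "i \<in> I1" "p = (i, m + int 1)" | i where "i \<in> I2" "p = (i, m + int 2)"
      using \<open>p \<in> C\<close> by (auto simp: C_def)
    then show ?thesis unfolding A_def by cases (use I1(3) I2(3) in simp_all)
  qed
  have cell: "(LINT z:dyadic_cell i j|lebesgue. w z) = ?J / (2 powi j)\<^sup>2" for i j
  proof -
    have "(LINT z:dyadic_cell i j|lebesgue. w z) = (LINT z:dyadic_cell i j|lebesgue. G (cell_map i j z))"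
      by (intro set_lebesgue_integral_cong) (auto simp: w)
    then show ?thesis using set_integral_dyadic_cell[OF G, of j i] by simp
  qed
  have p: "(2 powi (m + 1))\<^sup>2 = 4 * c\<^sup>2" "(2 powi (m + 2))\<^sup>2 = 16 * c\<^sup>2"
    by (simp_all add: c_def power_int_add power_mult_distrib)
  have "(LINT z:(\<Union>p\<in>C. A p)|lebesgue. w z) = (\<Sum>p\<in>C. LINT z:A p|lebesgue. w z)"
  proof (rule set_integral_finite_Union[OF C])
    show "disjoint_family_on A C"
      unfolding disjoint_family_on_def A_def using dyadic_cell_unique by (metis disjoint_iff prod_eqI)
    show "set_integrable lebesgue (A p) w" if "p \<in> C" for p
      by (rule set_integrable_subset[OF w_int _ AB[OF that]]) (simp add: A_def)
  qed (simp add: A_def)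
  also have "\<dots> = (\<Sum>p\<in>C. ?J / (2 powi snd p)\<^sup>2)" by (simp add: A_def cell)
  also have "\<dots> = (\<Sum>p\<in>(\<lambda>i. (i, m + 1)) ` I1. ?J / (2 powi snd p)\<^sup>2) + (\<Sum>p\<in>(\<lambda>i. (i, m + 2)) ` I2. ?J / (2 powi snd p)\<^sup>2)"
    unfolding C_def using I1 I2 by (intro sum.union_disjoint) auto
  also have "\<dots> = 3 * (?J / (4 * c\<^sup>2)) + 7 * (?J / (16 * c\<^sup>2))"
    using I1 I2 by (simp add: sum.reindex inj_on_def p)
  also have "\<dots> = 19 / 16 * a\<^sup>2 * ?J" by (simp add: a_def power_divide field_simps)
  finally have eq: "(LINT z:(\<Union>p\<in>C. A p)|lebesgue. w z) = 19 / 16 * a\<^sup>2 * ?J" .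
  \<comment> \<open>On the unit cell itself \<open>w\<close> integrates to the same value as
    \<open>G\<close>, so nonnegativity of \<open>w\<close> passes to the integral of
    \<open>G\<close>.\<close>
  have "?J = (LINT z:dyadic_cell 0 0|lebesgue. w z)" by (simp add: cell)
  also have "\<dots> \<ge> 0"
    unfolding set_lebesgue_integral_def
  proof (intro integral_nonneg_AE AE_I2)
    fix z show "0 \<le> indicat_real (dyadic_cell 0 0) z *\<^sub>R w z"
    proof (cases "z \<in> dyadic_cell 0 0")
      case True
      then have "z \<in> half_plane" unfolding half_plane_eq_Union by blast
      then show ?thesis using w_nonneg by simp
    qed simp
  qed
  finally have J: "?J \<ge> 0" .
  have "r\<^sup>2 / 8 * ?J \<le> 19 / 16 * a\<^sup>2 * ?J" using ar J by (intro mult_right_mono) auto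
  also have "\<dots> = (LINT z:(\<Union>p\<in>C. A p)|lebesgue. w z)" using eq by simp
  also have "\<dots> \<le> ?R"
    unfolding set_lebesgue_integral_def
  proof (rule integral_mono)
    have "set_integrable lebesgue (\<Union>p\<in>C. A p) w"
      by (rule set_integrable_subset[OF w_int]) (use C AB in \<open>auto simp: A_def\<close>)
    then show "integrable lebesgue (\<lambda>x. indicat_real (\<Union>p\<in>C. A p) x *\<^sub>R w x)"
      by (simp add: set_integrable_def)
    show "integrable lebesgue (\<lambda>x. indicat_real ?B x *\<^sub>R w x)"
      using w_int by (simp add: set_integrable_def)
    show "indicat_real (\<Union>p\<in>C. A p) x *\<^sub>R w x \<le> indicat_real ?B x *\<^sub>R w x" for x
    proof (cases "x \<in> ?B")
      case True
      then show ?thesis using w_nonneg[of x] by (simp add: indicator_def)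
    next
      case False
      then have "x \<notin> (\<Union>p\<in>C. A p)" using AB by blast
      with False show ?thesis by simp
    qed
  qed
  finally show ?thesis .
qed

section \<open>The boundary line is not negligible for Hausdorff measure\<close>

text \<open>Otherwise the boundary would be null and have covers of arbitrarily small total
  diameter; projecting one to the x-axis would cover [0, 1] by intervals of total length below
  1.\<close>

lemma AE_hausdorff1_frontier_half_plane_ex:
  assumes ae: "AE p in hausdorff1. p \<in> frontier half_plane \<longrightarrow> P p"
  shows "\<exists>p\<in>frontier half_plane. P p"
proof (rule ccontr)
  assume no: "\<not> ?thesis"
  from ae obtain N where N: "{p \<in> space hausdorff1. \<not> (p \<in> frontier half_plane \<longrightarrow> P p)} \<subseteq> N"
    "emeasure hausdorff1 N = 0" "N \<in> sets hausdorff1" by (rule AE_E)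
  have sub: "frontier half_plane \<subseteq> N" using N(1) no by (auto simp: space_hausdorff1)
  have "hausdorff1_pre 1 N \<le> hausdorff1_outer N"
    unfolding hausdorff1_outer_def by (intro SUP_upper) simp
  also have "\<dots> = 0" using N emeasure_hausdorff1 by metis
  \<comment> \<open>Each covering set will be replaced by an interval of twice its diameter, so 1/4
    leaves total length at most 1/2.\<close>
  also have "0 < ennreal (1 / 4)" by simp
  finally obtain E where E: "N \<subseteq> (\<Union>n. E n)" "\<And>n. bounded (E n)" "(\<Sum>n. ennreal (diameter (E n))) < ennreal (1 / 4)"
    unfolding hausdorff1_pre_def by (auto simp: INF_less_iff)
  \<comment> \<open>If \<open>E n\<close> is empty, the choice is arbitrary and harmless: no point
    is ever sought there.\<close>
  define a where "a n = (SOME z. z \<in> E n)" for n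
  define J where "J n = {fst (a n) - diameter (E n) .. fst (a n) + diameter (E n)}" for n
  have "{0..1} \<subseteq> (\<Union>n. J n)"
  proof
    fix x :: real assume "x \<in> {0..1}"
    have "(x, 0) \<in> frontier half_plane" by (simp add: frontier_half_plane)
    then obtain n where n: "(x, 0) \<in> E n" using sub E by blast
    then have "a n \<in> E n" unfolding a_def by (rule someI)
    then have "dist (x, 0) (a n) \<le> diameter (E n)" using n E(2) by (intro diameter_bounded_bound)
    then have "dist x (fst (a n)) \<le> diameter (E n)" using dist_fst_le[of "(x, 0)" "a n"] by simp
    then have "x \<in> J n" by (auto simp: J_def dist_real_def)
    then show "x \<in> (\<Union>n. J n)" by blast
  qed
  then have "emeasure lborel {0..1::real} \<le> emeasure lborel (\<Union>n. J n)"
    by (intro emeasure_mono) (auto simp: J_def)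
  also have "\<dots> \<le> (\<Sum>n. emeasure lborel (J n))"
    by (intro emeasure_subadditive_countably) (auto simp: J_def)
  also have "\<dots> = (\<Sum>n. 2 * ennreal (diameter (E n)))"
    using E(2) by (intro suminf_cong) (simp add: J_def diameter_ge_0 ennreal_mult[symmetric] flip: ennreal_numeral)
  also have "\<dots> = 2 * (\<Sum>n. ennreal (diameter (E n)))" by simp
  also have "\<dots> \<le> 2 * ennreal (1 / 4)" using E(3) by (intro mult_left_mono) auto
  also have "\<dots> = ennreal (1 / 2)" by (simp add: ennreal_mult[symmetric] flip: ennreal_numeral)
  finally have "ennreal 1 \<le> ennreal (1 / 2)" by simp
  then show False by (subst (asm) ennreal_le_iff) auto
qed

section \<open>The rescaled field\<close>

locale dyadic_field =
  fixes v u :: "real \<times> real \<Rightarrow> real \<times> real"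
  assumes v_bounded: "bounded_field (dyadic_cell 0 0) v"
    and v_div: "div_free_tangent (dyadic_cell 0 0) v"
    and u_cell: "z \<in> dyadic_cell i j \<Longrightarrow> u z = v (cell_map i j z)"
begin

lemma v_measurable: "v \<in> borel_measurable (lebesgue_on (dyadic_cell 0 0))"
  using v_bounded by (simp add: bounded_field_def)

lemma v_bound:
  obtains B where "\<And>z. z \<in> dyadic_cell 0 0 \<Longrightarrow> norm (v z) \<le> B"
  using v_bounded unfolding bounded_field_def bounded_iff by auto

lemma half_plane_cellE:
  assumes "z \<in> half_plane"
  obtains i j where "z \<in> dyadic_cell i j" "cell_map i j z \<in> dyadic_cell 0 0" "u z = v (cell_map i j z)"
proof -
  obtain i j where "z \<in> dyadic_cell i j" using assms unfolding half_plane_eq_Union by blast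
  with that[of i j] u_cell[of z i j] mem_dyadic_cell_iff[of z i j] show ?thesis by simp
qed

lemma u_measurable: "u \<in> borel_measurable (lebesgue_on half_plane)"
proof (rule measurable_piecewise_restrict[where C = "range (\<lambda>(i, j). dyadic_cell i j)"])
  show "space (lebesgue_on half_plane) \<subseteq> \<Union> (range (\<lambda>(i, j). dyadic_cell i j))"
    by (auto simp: half_plane_eq_Union)
  fix \<Omega> assume "\<Omega> \<in> range (\<lambda>(i, j). dyadic_cell i j)"
  then obtain i j where \<Omega>: "\<Omega> = dyadic_cell i j" by auto
  have sub: "dyadic_cell i j \<subseteq> half_plane" unfolding half_plane_eq_Union by blast
  show "\<Omega> \<inter> space (lebesgue_on half_plane) \<in> sets (lebesgue_on half_plane)"
    using sub unfolding \<Omega> by (simp add: sets_restrict_space_iff Int_absorb2)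
  have "restrict_space (lebesgue_on half_plane) \<Omega> = lebesgue_on \<Omega>"
    using sub unfolding \<Omega> by (simp add: restrict_restrict_space Int_absorb1)
  moreover have "u \<in> borel_measurable (lebesgue_on \<Omega>)"
    using cell_map_measurable_on[OF v_measurable, of i j] measurable_lebesgue_cong[of \<Omega> u "\<lambda>z. v (cell_map i j z)"]
    unfolding \<Omega> by (simp add: u_cell)
  ultimately show "u \<in> borel_measurable (restrict_space (lebesgue_on half_plane) \<Omega>)" by simp
qed simp

lemma u_bounded_field: "bounded_field half_plane u"
proof -
  obtain B where B: "\<And>z. z \<in> dyadic_cell 0 0 \<Longrightarrow> norm (v z) \<le> B" using v_bound by blast
  have "norm (u z) \<le> B" if "z \<in> half_plane" for z
    using half_plane_cellE[OF that] B by metis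
  then have "bounded (u ` half_plane)" unfolding bounded_iff by blast
  then show ?thesis using u_measurable by (simp add: bounded_field_def)
qed

text \<open>Transport the test function to the unit cell by the inverse of \<open>cell_map\<close>.
  It stays in \<open>C1_c\<close>, and its gradient only gains the factor 2^(-j), so tangency of
  \<open>v\<close> applies.\<close>

lemma lint_cell_grad:
  assumes \<phi>: "\<phi> \<in> C1_c"
  shows "(LINT z:dyadic_cell i j|lebesgue. u z \<bullet> grad \<phi> z) = 0"
proof -
  define c :: real where "c = 2 powi j"
  have c: "c \<noteq> 0" by (simp add: c_def)
  define \<psi> where "\<psi> w = \<phi> ((of_int i / c, 0) + (1 / c) *\<^sub>R w)" for w
  have \<psi>: "\<psi> \<in> C1_c" unfolding \<psi>_def using c by (intro C1_c_affine \<phi>) simp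
  have inv: "(of_int i / c, 0) + (1 / c) *\<^sub>R cell_map i j z = z" for z
    by (cases z) (use c in \<open>simp add: cell_map_Pair c_def[symmetric] diff_divide_distrib\<close>)
  have "GDERIV \<psi> w :> (1 / c) *\<^sub>R grad \<phi> ((of_int i / c, 0) + (1 / c) *\<^sub>R w)" for w
    unfolding \<psi>_def by (intro GDERIV_affine C1_c_GDERIV \<phi>)
  then have "grad \<psi> w = (1 / c) *\<^sub>R grad \<phi> ((of_int i / c, 0) + (1 / c) *\<^sub>R w)" for w
    by (rule grad_eqI)
  then have eq: "grad \<psi> (cell_map i j z) = (1 / c) *\<^sub>R grad \<phi> z" for z by (simp only: inv)
  have m: "(\<lambda>w. v w \<bullet> grad \<psi> w) \<in> borel_measurable (lebesgue_on (dyadic_cell 0 0))"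
  proof (intro borel_measurable_inner v_measurable)
    have "grad \<psi> \<in> borel_measurable lebesgue" using C1_c_integrable_grad[OF \<psi>] by (rule borel_measurable_integrable)
    then show "grad \<psi> \<in> borel_measurable (lebesgue_on (dyadic_cell 0 0))" by (rule measurable_restrict_space1)
  qed
  have "(LINT z:dyadic_cell i j|lebesgue. u z \<bullet> grad \<phi> z)
      = (LINT z:dyadic_cell i j|lebesgue. c * (v (cell_map i j z) \<bullet> grad \<psi> (cell_map i j z)))"
    using c by (intro set_lebesgue_integral_cong) (auto simp: u_cell eq)
  also have "\<dots> = c * (LINT z:dyadic_cell i j|lebesgue. v (cell_map i j z) \<bullet> grad \<psi> (cell_map i j z))"
    by simp
  also have "(LINT z:dyadic_cell i j|lebesgue. v (cell_map i j z) \<bullet> grad \<psi> (cell_map i j z)) = 0"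
  proof -
    have "(LINT w:dyadic_cell 0 0|lebesgue. v w \<bullet> grad \<psi> w) = 0"
      using v_div \<psi> by (simp add: div_free_tangent_def integral_lebesgue_on_eq)
    with set_integral_dyadic_cell[OF m, of j i] show ?thesis by simp
  qed
  finally show ?thesis by simp
qed

text \<open>Boundedness of \<open>u\<close> dominates the integrand by a multiple of the integrable
  \<open>grad \<phi>\<close>, so the vanishing cell integrals may be summed.\<close>

lemma normal_trace_eq_0:
  assumes \<phi>: "\<phi> \<in> C1_c"
  shows "normal_trace u \<phi> = 0"
proof -
  obtain B where B: "\<And>z. z \<in> half_plane \<Longrightarrow> norm (u z) \<le> B"
    using u_bounded_field unfolding bounded_field_def bounded_iff by auto
  have g: "integrable lebesgue (grad \<phi>)" by (rule C1_c_integrable_grad[OF \<phi>])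
  have "(\<lambda>z. u z \<bullet> grad \<phi> z) \<in> borel_measurable (lebesgue_on half_plane)"
    using u_measurable measurable_restrict_space1[OF borel_measurable_integrable[OF g]] by (rule borel_measurable_inner)
  then have m: "(\<lambda>z. indicat_real half_plane z *\<^sub>R (u z \<bullet> grad \<phi> z)) \<in> borel_measurable lebesgue"
    by (simp add: borel_measurable_restrict_space_iff)
  have "set_integrable lebesgue half_plane (\<lambda>z. u z \<bullet> grad \<phi> z)"
    unfolding set_integrable_def
  proof (rule Bochner_Integration.integrable_bound[OF _ m])
    show "integrable lebesgue (\<lambda>z. B *\<^sub>R grad \<phi> z)" using g by simp
    show "AE z in lebesgue. norm (indicat_real half_plane z *\<^sub>R (u z \<bullet> grad \<phi> z)) \<le> norm (B *\<^sub>R grad \<phi> z)"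
    proof (rule AE_I2)
      fix z show "norm (indicat_real half_plane z *\<^sub>R (u z \<bullet> grad \<phi> z)) \<le> norm (B *\<^sub>R grad \<phi> z)"
      proof (cases "z \<in> half_plane")
        case True
        have "\<bar>u z \<bullet> grad \<phi> z\<bar> \<le> norm (u z) * norm (grad \<phi> z)" by (rule Cauchy_Schwarz_ineq2)
        also have "\<dots> \<le> \<bar>B\<bar> * norm (grad \<phi> z)" using B[OF True] by (intro mult_right_mono) auto
        finally show ?thesis using True by simp
      qed simp
    qed
  qed
  then have "(LINT z:half_plane|lebesgue. u z \<bullet> grad \<phi> z) = 0"
    by (rule lint_half_plane_eq_0) (rule lint_cell_grad[OF \<phi>])
  then show ?thesis by (simp add: normal_trace_def integral_lebesgue_on_eq)
qed

lemma u_div_free: "div_free half_plane u"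
  using normal_trace_eq_0 Cinf_c_subset_C1_c by (auto simp: div_free_def normal_trace_def)

lemma u_periodic:
  fixes k :: int
  assumes "0 < y" "y < 2 powi (- k)"
  shows "u (x + 2 powi (- k - 1), y) = u (x, y)"
proof -
  have "(x, y) \<in> half_plane" using assms by (simp add: half_plane_def)
  then obtain i j where ij: "(x, y) \<in> dyadic_cell i j" using half_plane_cellE by blast
  then have "(2::real) powi (- j) < 2 powi (- k)" using assms(2) by (simp add: dyadic_cell_def)
  \<comment> \<open>The bottom of the cell lies below height 2^(-k), which forces a level finer than
    \<open>k\<close>.\<close>
  then have "k < j" by (metis linorder_not_less neg_le_iff_le one_le_numeral power_int_increasing)
  \<comment> \<open>The shift 2^(-k-1) is 2^n cell sides at level \<open>j\<close>: an integer
    number since j \<ge> k + 1. It moves the index \<open>i\<close> by 2^n and leaves the image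
    under \<open>cell_map\<close> unchanged.\<close>
  define n where "n = nat (j - k - 1)"
  have "(2::real) powi j * 2 powi (- k - 1) = 2 powi (int n)"
    using \<open>k < j\<close> by (simp add: power_int_add[symmetric] n_def algebra_simps)
  then have eq: "(2::real) powi j * 2 powi (- k - 1) = of_int (2 ^ n)" by simp
  have cm: "cell_map (i + 2 ^ n) j (x + 2 powi (- k - 1), y) = cell_map i j (x, y)"
    using eq by (simp add: cell_map_Pair distrib_left)
  with ij have "(x + 2 powi (- k - 1), y) \<in> dyadic_cell (i + 2 ^ n) j"
    by (simp add: mem_dyadic_cell_iff[of _ i j] mem_dyadic_cell_iff[of _ "i + 2 ^ n" j])
  with ij cm show ?thesis by (simp add: u_cell)
qed

text \<open>The free \<open>t\<close> serves two purposes: t = 0 gives the lower limit in (iii), and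
  t = f p refutes a candidate trace value.\<close>

lemma half_disc_normal_component:
  assumes "0 < r"
  shows "r\<^sup>2 / 8 * (LINT z|lebesgue_on (dyadic_cell 0 0). \<bar>v z \<bullet> e2 - t\<bar>) \<le>
    (LINT z|lebesgue_on (ball (xbar, 0) r \<inter> half_plane). \<bar>u z \<bullet> e2 - t\<bar>)"
proof -
  let ?B = "ball (xbar, 0) r \<inter> half_plane"
  have B: "?B \<in> sets lebesgue" by (rule fmeasurableD) simp
  obtain b where b: "\<And>z. z \<in> half_plane \<Longrightarrow> norm (u z) \<le> b"
    using u_bounded_field unfolding bounded_field_def bounded_iff by auto
  have "r\<^sup>2 / 8 * (LINT z:dyadic_cell 0 0|lebesgue. \<bar>v z \<bullet> e2 - t\<bar>) \<le> (LINT z:?B|lebesgue. \<bar>u z \<bullet> e2 - t\<bar>)"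
  proof (rule half_disc_lower_bound)
    show "(\<lambda>z. \<bar>v z \<bullet> e2 - t\<bar>) \<in> borel_measurable (lebesgue_on (dyadic_cell 0 0))"
      using v_measurable by measurable
    show "\<bar>u z \<bullet> e2 - t\<bar> = \<bar>v (cell_map i j z) \<bullet> e2 - t\<bar>" if "z \<in> dyadic_cell i j" for i j z
      using that by (simp add: u_cell)
    show "set_integrable lebesgue ?B (\<lambda>z. \<bar>u z \<bullet> e2 - t\<bar>)"
    proof (rule set_integrable_lebesgue_bounded)
      have "u \<in> borel_measurable (lebesgue_on ?B)"
        using measurable_restrict_space1[OF u_measurable, of "ball (xbar, 0) r"]
        by (simp add: restrict_restrict_space Int_commute)
      then show "(\<lambda>z. \<bar>u z \<bullet> e2 - t\<bar>) \<in> borel_measurable (lebesgue_on ?B)" by measurable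
      fix z assume "z \<in> ?B"
      then have "norm (u z) \<le> b" using b by simp
      moreover have "\<bar>u z \<bullet> e2\<bar> \<le> norm (u z)"
        using Cauchy_Schwarz_ineq2[of "u z" e2] by (simp add: e2_def)
      ultimately show "norm \<bar>u z \<bullet> e2 - t\<bar> \<le> b + \<bar>t\<bar>" by simp
    qed simp
  qed (use assms in auto)
  then show ?thesis using B by (simp add: integral_lebesgue_on_eq)
qed

lemma v_mean_normal_component: "(LINT z|lebesgue_on (dyadic_cell 0 0). v z \<bullet> e2) = 0"
proof -
  obtain \<phi> where \<phi>: "\<phi> \<in> C1_c" "\<And>z. z \<in> dyadic_cell 0 0 \<Longrightarrow> grad \<phi> z = e2"
    using vertical_test_function by blast
  have "(LINT z|lebesgue_on (dyadic_cell 0 0). v z \<bullet> e2) = (LINT z|lebesgue_on (dyadic_cell 0 0). v z \<bullet> grad \<phi> z)"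
    by (intro Bochner_Integration.integral_cong) (auto simp: \<phi>(2))
  then show ?thesis using v_div \<phi>(1) by (simp add: div_free_tangent_def)
qed

text \<open>The unit cell has area 1 and v \<bullet> e2 has mean zero, so v \<bullet> e2 - t
  integrates to -t; then move the absolute value inside.\<close>

lemma abs_le_lint_v_normal_component: "\<bar>t\<bar> \<le> (LINT z|lebesgue_on (dyadic_cell 0 0). \<bar>v z \<bullet> e2 - t\<bar>)"
proof -
  let ?M = "lebesgue_on (dyadic_cell 0 0)"
  obtain b where b: "\<And>z. z \<in> dyadic_cell 0 0 \<Longrightarrow> norm (v z) \<le> b" using v_bound by blast
  interpret finite_measure ?M by (rule finite_measure_lebesgue_on) simp
  have "integrable ?M (\<lambda>z. v z \<bullet> e2)"
  proof (rule integrable_const_bound)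
    show "AE z in ?M. norm (v z \<bullet> e2) \<le> b"
    proof (rule AE_I2)
      fix z assume "z \<in> space ?M"
      then have "norm (v z) \<le> b" using b by simp
      moreover have "\<bar>v z \<bullet> e2\<bar> \<le> norm (v z)"
        using Cauchy_Schwarz_ineq2[of "v z" e2] by (simp add: e2_def)
      ultimately show "norm (v z \<bullet> e2) \<le> b" by simp
    qed
  qed (use v_measurable in measurable)
  then have "(LINT z|?M. v z \<bullet> e2 - t) = - t * measure ?M (space ?M)"
    by (simp add: v_mean_normal_component)
  also have "measure ?M (space ?M) = 1"
    using measure_unit_cell by (simp add: measure_restrict_space)
  finally have "\<bar>t\<bar> = \<bar>LINT z|?M. v z \<bullet> e2 - t\<bar>" by simp
  also have "\<dots> \<le> (LINT z|?M. \<bar>v z \<bullet> e2 - t\<bar>)" by (rule integral_abs_bound)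
  finally show ?thesis .
qed

lemma Liminf_half_disc_normal_component:
  "ereal (1 / 8 * (LINT z|lebesgue_on (dyadic_cell 0 0). \<bar>v z \<bullet> e2\<bar>)) \<le>
   Liminf (at_right 0) (\<lambda>r. ereal (1 / r\<^sup>2 * (LINT z|lebesgue_on (ball (xbar, 0) r \<inter> half_plane). \<bar>u z \<bullet> e2\<bar>)))"
proof (rule Liminf_bounded)
  have "1 / 8 * (LINT z|lebesgue_on (dyadic_cell 0 0). \<bar>v z \<bullet> e2\<bar>) \<le>
      1 / r\<^sup>2 * (LINT z|lebesgue_on (ball (xbar, 0) r \<inter> half_plane). \<bar>u z \<bullet> e2\<bar>)" if "r > 0" for r
    using half_disc_normal_component[OF that, of 0 xbar] that by (simp add: field_simps)
  then show "\<forall>\<^sub>F r in at_right 0. ereal (1 / 8 * (LINT z|lebesgue_on (dyadic_cell 0 0). \<bar>v z \<bullet> e2\<bar>)) \<le>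
      ereal (1 / r\<^sup>2 * (LINT z|lebesgue_on (ball (xbar, 0) r \<inter> half_plane). \<bar>u z \<bullet> e2\<bar>))"
    by (auto simp: eventually_at_right_field intro!: exI[of _ 1])
qed

lemma not_admits_normal_lebesgue_trace:
  assumes pos: "0 < (LINT z|lebesgue_on (dyadic_cell 0 0). \<bar>v z \<bullet> e2\<bar>)"
  shows "\<not> admits_normal_lebesgue_trace u"
proof
  assume "admits_normal_lebesgue_trace u"
  then obtain f where f: "is_normal_lebesgue_trace u f" unfolding admits_normal_lebesgue_trace_def ..
  \<comment> \<open>The trace condition concerns every sequence of radii and almost every point; one
    sequence and one point suffice for a contradiction.\<close>
  define r :: "nat \<Rightarrow> real" where "r k = 1 / Suc k" for k
  have r: "r k > 0" for k by (simp add: r_def)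
  have "filterlim r (at_right 0) sequentially"
    unfolding filterlim_at using r LIMSEQ_inverse_real_of_nat
    by (auto simp: r_def[abs_def] inverse_eq_divide)
  with f have "AE p in hausdorff1. p \<in> frontier half_plane \<longrightarrow>
      (\<lambda>k. 1 / (r k)\<^sup>2 * (LINT z|lebesgue_on (ball p (r k) \<inter> half_plane). \<bar>u z \<bullet> grad bdry_dist z - f p\<bar>)) \<longlonglongrightarrow> 0"
    by (simp add: is_normal_lebesgue_trace_def)
  from AE_hausdorff1_frontier_half_plane_ex[OF this] obtain p where p: "p \<in> frontier half_plane"
    "(\<lambda>k. 1 / (r k)\<^sup>2 * (LINT z|lebesgue_on (ball p (r k) \<inter> half_plane). \<bar>u z \<bullet> grad bdry_dist z - f p\<bar>)) \<longlonglongrightarrow> 0"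
    by blast
  obtain xbar where xbar: "p = (xbar, 0)" using p(1) by (cases p) (auto simp: frontier_half_plane)
  define c where "c = (LINT z|lebesgue_on (dyadic_cell 0 0). \<bar>v z \<bullet> e2 - f p\<bar>)"
  \<comment> \<open>For f p = 0 this is the assumption \<open>pos\<close>; otherwise c \<ge> |f p| >
    0.\<close>
  have "c > 0"
    using abs_le_lint_v_normal_component[of "f p"] pos unfolding c_def by (cases "f p = 0") auto
  have "c / 8 \<le> 1 / (r k)\<^sup>2 * (LINT z|lebesgue_on (ball p (r k) \<inter> half_plane). \<bar>u z \<bullet> grad bdry_dist z - f p\<bar>)" for k
    using half_disc_normal_component[OF r[of k], of "f p" xbar] r[of k]
    unfolding grad_bdry_dist c_def xbar by (simp add: field_simps)
  then have "c / 8 \<le> 0" by (intro LIMSEQ_le_const[OF p(2)]) auto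
  with \<open>c > 0\<close> show False by simp
qed

end

theorem lemma3p11:
  fixes Q :: "(real \<times> real) set"
    and v u :: "real \<times> real \<Rightarrow> real \<times> real"
  assumes Q: "Q = {(x, y). 0 \<le> x \<and> x < 1 \<and> 1 \<le> y \<and> y < 2}"
    and v_bounded: "bounded_field Q v"
    and v_div: "div_free_tangent Q v"
    and u: "\<And>(i::int) (j::int) x y. (x, y) \<in> dyadic_cell i j \<Longrightarrow>
              u (x, y) = v (2 powi j * x - of_int i, 2 powi j * y)"
  shows "(bounded_field half_plane u \<and> div_free half_plane u \<and>
            (\<forall>\<phi>\<in>Cinf_c. normal_trace u \<phi> = 0)) \<and>
         (\<forall>(k::int) x y. 0 < y \<and> y < 2 powi (- k) \<longrightarrow>
            u (x + 2 powi (- k - 1), y) = u (x, y)) \<and>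
         (\<forall>xbar. Liminf (at_right 0) (\<lambda>r. ereal (1 / r\<^sup>2 *
              (LINT z|lebesgue_on (ball (xbar, 0) r \<inter> half_plane). \<bar>u z \<bullet> e2\<bar>)))
            \<ge> ereal (1 / 8 * (LINT z|lebesgue_on Q. \<bar>v z \<bullet> e2\<bar>))) \<and>
         ((LINT z|lebesgue_on Q. \<bar>v z \<bullet> e2\<bar>) > 0 \<longrightarrow> \<not> admits_normal_lebesgue_trace u)"
proof -
  have Q_cell: "Q = dyadic_cell 0 0" unfolding Q by (auto simp: mem_unit_cell)
  interpret dyadic_field v u
  proof
    show "u z = v (cell_map i j z)" if "z \<in> dyadic_cell i j" for z i j
      using u that by (cases z) (simp add: cell_map_Pair)
  qed (use v_bounded v_div Q_cell in auto)
  show ?thesis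
    unfolding Q_cell
    using u_bounded_field u_div_free normal_trace_eq_0[OF subsetD[OF Cinf_c_subset_C1_c]]
      u_periodic Liminf_half_disc_normal_component not_admits_normal_lebesgue_trace
    by (intro conjI allI ballI impI) simp_all
qed

end
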